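(* We have $$A^{(3)}(x_1,x_2,x_3,\dots)=1+\frac{x_1^2x_2A^{(3)}(x_1,x_2x_3,x_3x_4,\dots)}{1-x_1^2x_2A^{(3)}(x_1,x_2x_3^2x_4,x_3x_4^2x_5,\dots)},$$ and $$B^{(3)}(x_1,x_2,x_3,\dots)=x_1A^{(3)}(x_1,x_2x_3,x_3x_4\dots).$$
   Context: A permutation $\pi$ is a Dumont permutation (of the first kind) if each even integer in $\pi$ is followed by a smaller integer, and each odd integer is either followed by a larger integer or is the last element of $\pi$. Let $\mathcal{D}$ be the set of Dumont permutations of all sizes (including the empty one) avoiding $1\mbox{-}3\mbox{-}2$. Generalized patterns: letters separated by dashes may be at any distance, adjacent letters (as $21$ in $21\mbox{-}3\mbox{-}\cdots\mbox{-}j$) must be adjacent in $\pi$. For a pattern $\tau$, $\tau(\pi)$ is its number of occurrences; $1(\pi)$ is the length of $\pi$. Define $\mathcal{C}(x_1,x_2,\dots)=\sum_{\pi\in\mathcal{D}}x_1^{1(\pi)}\prod_{j\geq2}x_j^{21\mbox{-}3\mbox{-}\dots\mbox{-} j(\pi)}$, $A^{(3)}=\frac12(\mathcal{C}(x_1,x_2,\dots)+\mathcal{C}(-x_1,x_2,\dots))$, $B^{(3)}=\frac12(\mathcal{C}(x_1,x_2,\dots)-\mathcal{C}(-x_1,x_2,\dots))$. *)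

theory Defs
  imports
    "HOL-Computational_Algebra.Formal_Power_Series"
    "HOL-Combinatorics.Multiset_Permutations"
begin

text \<open>
  Permutations of size \<open>n\<close> are written in one-line notation, as the elements of
  \<^term>\<open>permutations_of_set {1..n::nat}\<close>.
\<close>

definition dumont :: "nat list \<Rightarrow> bool" where
  "dumont \<pi> \<longleftrightarrow>
     (\<forall>i<length \<pi>.
        (even (\<pi> ! i) \<longrightarrow> Suc i < length \<pi> \<and> \<pi> ! Suc i < \<pi> ! i) \<and>
        (odd (\<pi> ! i) \<longrightarrow> Suc i = length \<pi> \<or> \<pi> ! i < \<pi> ! Suc i))"

text \<open>
  A generalized pattern is the list of its dash-free blocks, e.g. \<open>1-3-2\<close> is
  \<open>[[1], [3], [2]]\<close> and \<open>21-3\<close> is \<open>[[2, 1], [3]]\<close>.  An occurrence is recorded as the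
  increasing list of the positions it occupies; the list \<open>ss\<close> below holds the position
  at which each block starts, so that the letters of one block are adjacent.
\<close>

definition occurrences :: "nat list list \<Rightarrow> nat list \<Rightarrow> nat list set" where
  "occurrences \<tau> \<pi> =
     {ps. (\<exists>ss. length ss = length \<tau> \<and>
                ps = concat (map2 (\<lambda>s b. [s..<s + length b]) ss \<tau>)) \<and>
          sorted_wrt (<) ps \<and>
          set ps \<subseteq> {..<length \<pi>} \<and>
          (\<forall>a<length ps. \<forall>b<length ps.
             \<pi> ! (ps ! a) < \<pi> ! (ps ! b) \<longleftrightarrow> concat \<tau> ! a < concat \<tau> ! b)}"

definition occ :: "nat list list \<Rightarrow> nat list \<Rightarrow> nat" where
  "occ \<tau> \<pi> = card (occurrences \<tau> \<pi>)"

definition avoids :: "nat list \<Rightarrow> nat list list \<Rightarrow> bool" where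
  "avoids \<pi> \<tau> \<longleftrightarrow> occurrences \<tau> \<pi> = {}"

text \<open>The pattern \<open>21-3-\<dots>-j\<close>, for \<open>j \<ge> 2\<close>.\<close>

definition pat21 :: "nat \<Rightarrow> nat list list" where
  "pat21 j = [2, 1] # map (\<lambda>k. [k]) [3..<Suc j]"

definition dumont_avoid_132 :: "nat list set" where
  "dumont_avoid_132 =
     {\<pi>. (\<exists>n. \<pi> \<in> permutations_of_set {1..n}) \<and> dumont \<pi> \<and> avoids \<pi> [[1], [3], [2]]}"

text \<open>
  Generating functions are formal power series in \<open>x\<^sub>1\<close> (the indeterminate \<^term>\<open>fps_X\<close>);
  \<open>x\<^sub>2, x\<^sub>3, \<dots>\<close> are given by a sequence \<open>x\<close> of elements of a field of characteristic \<open>0\<close>,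
  and \<open>x 0\<close>, \<open>x 1\<close> are not used.  Since the field and the sequence are arbitrary, the
  \<open>x\<^sub>j\<close> may be taken to be the independent indeterminates of the field of fractions of
  the polynomial ring over the rationals in \<open>x\<^sub>2, x\<^sub>3, \<dots>\<close>.  The product over all
  \<open>j \<ge> 2\<close> stops at \<open>j = length \<pi>\<close>, because the longer patterns do not occur in \<open>\<pi>\<close>
  and contribute the factor \<open>1\<close>.
\<close>

definition C_gf :: "(nat \<Rightarrow> 'a::field_char_0) \<Rightarrow> 'a fps" where
  "C_gf x = Abs_fps (\<lambda>n. \<Sum>\<pi> | \<pi> \<in> dumont_avoid_132 \<and> length \<pi> = n.
                          \<Prod>j=2..length \<pi>. x j ^ occ (pat21 j) \<pi>)"

text \<open>Composition with \<^term>\<open>- fps_X\<close> is the substitution of \<open>-x\<^sub>1\<close> for \<open>x\<^sub>1\<close>.\<close>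

definition A3 :: "(nat \<Rightarrow> 'a::field_char_0) \<Rightarrow> 'a fps" where
  "A3 x = fps_const (1/2) * (C_gf x + (C_gf x oo (- fps_X)))"

definition B3 :: "(nat \<Rightarrow> 'a::field_char_0) \<Rightarrow> 'a fps" where
  "B3 x = fps_const (1/2) * (C_gf x - (C_gf x oo (- fps_X)))"

end

theory Submission
  imports Defs
begin

unbundle fps_syntax

text \<open>
  A permutation of size \<open>n\<close> avoiding \<open>1-3-2\<close> is \<open>\<tau> n \<rho>\<close> with every letter of \<open>\<tau>\<close> above
  every letter of \<open>\<rho>\<close>. If it is a Dumont permutation and \<open>n\<close> is odd, then \<open>\<rho>\<close> is empty and
  \<open>\<tau>\<close> is an arbitrary object of size \<open>n - 1\<close>. If \<open>n\<close> is even, then \<open>\<rho>\<close> is nonempty, and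
  either \<open>\<tau>\<close> is empty, or \<open>\<rho>\<close> has even size and \<open>\<tau>\<close> is a shifted object of odd size: for
  \<open>\<rho>\<close> of odd size the least letter of \<open>\<tau>\<close> would be even and followed by a larger one.
  Appending a maximal letter replaces \<open>x\<^sub>j\<close> by \<open>x\<^sub>j x\<^sub>j\<^sub>+\<^sub>1\<close> in the weight, and the weight of
  \<open>\<tau> n \<rho>\<close> is \<open>x\<^sub>2\<close> (for the descent into \<open>\<rho>\<close>) times the weights of \<open>\<tau> n\<close> and \<open>\<rho>\<close>.
\<close>

section \<open>Occurrences of 21-3-...-j encoded by positions\<close>

text \<open>
  An occurrence of \<open>21-3-\<dots>-(k + 2)\<close> is recorded as the position \<open>s\<close> of the letter \<open>2\<close>,
  which fixes that of \<open>1\<close> as \<open>s + 1\<close>, and the list \<open>qs\<close> of the positions of the other \<open>k\<close> letters.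
\<close>

definition inst21 :: "nat \<Rightarrow> nat list \<Rightarrow> (nat \<times> nat list) set" where
  "inst21 k \<pi> =
     {(s, qs). length qs = k \<and> Suc s < length \<pi> \<and> set qs \<subseteq> {..<length \<pi>} \<and>
        sorted_wrt (<) (Suc s # qs) \<and> sorted_wrt (<) (map (nth \<pi>) (Suc s # s # qs))}"

lemma finite_inst21: "finite (inst21 k \<pi>)"
proof (rule finite_subset)
  show "inst21 k \<pi> \<subseteq> {..<length \<pi>} \<times> {qs. set qs \<subseteq> {..<length \<pi>} \<and> length qs = k}"
    by (auto simp: inst21_def)
  show "finite ({..<length \<pi>} \<times> {qs. set qs \<subseteq> {..<length \<pi>} \<and> length qs = k})"
    by (intro finite_cartesian_product finite_lists_length_eq) auto
qed

lemma concat_singleton_blocks: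
  "length qs = length ks \<Longrightarrow>
     concat (map2 (\<lambda>s b. [s..<s + length b]) qs (map (\<lambda>k. [k]) ks)) = qs"
  by (induction qs ks rule: list_induct2) auto

lemma sorted_wrt_less_nth_iff:
  fixes u :: "'a::linorder list"
  assumes "sorted_wrt (<) u" "i < length u" "j < length u"
  shows "u ! i < u ! j \<longleftrightarrow> i < j"
proof
  assume *: "u ! i < u ! j"
  show "i < j"
  proof (rule ccontr)
    assume "\<not> i < j"
    then have "j < i \<or> j = i" by auto
    then show False
      using * sorted_wrt_nth_less[OF assms(1), of j i] assms(2) by auto
  qed
qed (use sorted_wrt_nth_less[OF assms(1)] assms in auto)

text \<open>Exchanging the first two positions turns 2 1 3 4 ... into an increasing word, and being
  order-isomorphic to an increasing word means being strictly sorted. The involution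
  \<open>f\<close> is this exchange, and \<open>Suc (f i)\<close> is the letter of the pattern at
  position \<open>i\<close>.\<close>

lemma order_iso_213:
  fixes a b :: nat and r :: "nat list"
  shows "(\<forall>i<length (a # b # r). \<forall>j<length (a # b # r).
            (a # b # r) ! i < (a # b # r) ! j \<longleftrightarrow>
            (2 # 1 # [3..<3 + length r]) ! i < (2 # 1 # [3..<3 + length r]) ! j)
         \<longleftrightarrow> sorted_wrt (<) (b # a # r)" (is "?L \<longleftrightarrow> ?R")
proof -
  define f :: "nat \<Rightarrow> nat" where "f i = (if i = 0 then 1 else if i = 1 then 0 else i)" for i
  have v: "(a # b # r) ! i = (b # a # r) ! f i" for i
    by (auto simp: f_def nth_Cons split: nat.splits)
  have w: "(2 # 1 # [3..<3 + length r]) ! i = Suc (f i)" if "i < length (a # b # r)" for i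
    using that by (auto simp: f_def nth_Cons split: nat.splits)
  have f: "f i < length (a # b # r) \<longleftrightarrow> i < length (a # b # r)" "f (f i) = i" for i
    by (auto simp: f_def)
  have "?L \<longleftrightarrow> (\<forall>i<length (a # b # r). \<forall>j<length (a # b # r).
           (b # a # r) ! f i < (b # a # r) ! f j \<longleftrightarrow> f i < f j)" (is "_ \<longleftrightarrow> ?M")
    by (simp only: v w Suc_less_eq cong: conj_cong imp_cong)
  also have "?M \<longleftrightarrow> ?R"
  proof
    assume ?M
    then have "(b # a # r) ! i < (b # a # r) ! j" if "i < j" "j < length (b # a # r)" for i j
    proof -
      have "f i < length (a # b # r)" "f j < length (a # b # r)"
        using that by (auto simp: f_def)
      then show ?thesis
        using \<open>?M\<close> that(1) f(2) by metis
    qed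
    then show ?R unfolding sorted_wrt_iff_nth_less by blast
  next
    assume R: ?R
    show ?M
      using sorted_wrt_less_nth_iff[OF R] f(1) by (metis length_Cons)
  qed
  finally show ?thesis .
qed

text \<open>Only the first block has two letters; it forces the positions \<open>s\<close> and
  \<open>Suc s\<close>, while each other block contributes one free position.\<close>

lemma occurrences_pat21:
  "occurrences (pat21 (k + 2)) \<pi> = (\<lambda>(s, qs). s # Suc s # qs) ` inst21 k \<pi>"
proof -
  have c: "concat (pat21 (k + 2)) = 2 # 1 # [3..<3 + k]"
    by (simp add: pat21_def numeral_3_eq_3 del: upt_Suc)
  have P: "(\<exists>ss. length ss = length (pat21 (k + 2)) \<and>
            ps = concat (map2 (\<lambda>s b. [s..<s + length b]) ss (pat21 (k + 2)))) \<longleftrightarrow>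
          (\<exists>s qs. length qs = k \<and> ps = s # Suc s # qs)" for ps
  proof
    assume "\<exists>ss. length ss = length (pat21 (k + 2)) \<and>
            ps = concat (map2 (\<lambda>s b. [s..<s + length b]) ss (pat21 (k + 2)))"
    then obtain ss where ss: "length ss = Suc k"
      "ps = concat (map2 (\<lambda>s b. [s..<s + length b]) ss (pat21 (k + 2)))"
      by (auto simp: pat21_def simp del: upt_Suc)
    then obtain s qs where "ss = s # qs" "length qs = k" by (cases ss) auto
    then show "\<exists>s qs. length qs = k \<and> ps = s # Suc s # qs"
      using ss by (auto simp: pat21_def concat_singleton_blocks upt_conv_Cons simp del: upt_Suc)
  next
    assume "\<exists>s qs. length qs = k \<and> ps = s # Suc s # qs"
    then obtain s qs where "length qs = k" "ps = s # Suc s # qs" by blast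
    then show "\<exists>ss. length ss = length (pat21 (k + 2)) \<and>
            ps = concat (map2 (\<lambda>s b. [s..<s + length b]) ss (pat21 (k + 2)))"
      by (intro exI[of _ "s # qs"])
        (auto simp: pat21_def concat_singleton_blocks upt_conv_Cons simp del: upt_Suc)
  qed
  have Q: "(\<forall>a<length ps. \<forall>b<length ps.
             \<pi> ! (ps ! a) < \<pi> ! (ps ! b) \<longleftrightarrow> concat (pat21 (k + 2)) ! a < concat (pat21 (k + 2)) ! b)
           \<longleftrightarrow> sorted_wrt (<) (map (nth \<pi>) (Suc s # s # qs))"
    if ps: "ps = s # Suc s # qs" "length qs = k" for ps s qs
  proof -
    have nth: "\<pi> ! (ps ! a) = (\<pi> ! s # \<pi> ! Suc s # map (nth \<pi>) qs) ! a" if "a < length ps" for a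
      using that nth_map[of a ps "nth \<pi>"] ps by simp
    have len: "length ps = length (\<pi> ! s # \<pi> ! Suc s # map (nth \<pi>) qs)" using ps by simp
    show ?thesis
      using order_iso_213[of "\<pi> ! s" "\<pi> ! Suc s" "map (nth \<pi>) qs"] nth c ps(2)
      unfolding len by (simp del: length_Cons upt_Suc nth_Cons_Suc cong: imp_cong)
  qed
  show ?thesis
    unfolding occurrences_def P
  proof (intro set_eqI iffI, goal_cases)
    case (1 ps)
    then obtain s qs where ps: "ps = s # Suc s # qs" "length qs = k" by blast
    have "(s, qs) \<in> inst21 k \<pi>"
      using 1 Q[OF ps] ps by (auto simp: inst21_def)
    then show ?case using ps by force
  next
    case (2 ps)
    then obtain s qs where ps: "ps = s # Suc s # qs" "length qs = k" "(s, qs) \<in> inst21 k \<pi>"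
      by (auto simp: inst21_def)
    then show ?case
      using Q[OF ps(1,2)] by (auto simp: inst21_def)
  qed
qed

lemma occ_pat21: "occ (pat21 (k + 2)) \<pi> = card (inst21 k \<pi>)"
  unfolding occ_def occurrences_pat21 by (rule card_image) (auto simp: inj_on_def)

text \<open>An occurrence needs \<open>j\<close> distinct positions. This lets the product defining
  a weight run up to any larger bound.\<close>

lemma occ_pat21_long:
  assumes "length \<pi> < j" "2 \<le> j"
  shows "occ (pat21 j) \<pi> = 0"
proof -
  obtain k where k: "j = k + 2" using assms(2) by (metis add.commute le_Suc_ex)
  have "False" if "(s, qs) \<in> inst21 k \<pi>" for s qs
  proof -
    have "distinct (s # Suc s # qs)" "set (s # Suc s # qs) \<subseteq> {..<length \<pi>}"
      using that by (auto simp: inst21_def strict_sorted_iff)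
    then have "length (s # Suc s # qs) \<le> length \<pi>"
      by (metis card_lessThan card_mono distinct_card finite_lessThan)
    then show False using that assms k by (auto simp: inst21_def)
  qed
  then have "inst21 k \<pi> = {}" by auto
  then show ?thesis by (simp add: k occ_pat21[of k, simplified])
qed

section \<open>Effect of relabelling and concatenation on occurrences\<close>

lemma inst21_map:
  assumes "strict_mono f"
  shows "inst21 k (map f \<pi>) = inst21 k \<pi>"
proof -
  have *: "sorted_wrt (<) (map (nth (map f \<pi>)) ps) \<longleftrightarrow> sorted_wrt (<) (map (nth \<pi>) ps)"
    if "set ps \<subseteq> {..<length \<pi>}" for ps
  proof -
    have "map (nth (map f \<pi>)) ps = map f (map (nth \<pi>) ps)" using that by auto
    then show ?thesis
      by (metis (mono_tags, lifting) sorted_wrt_map sorted_wrt_mono_rel strict_mono_less[OF assms])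
  qed
  have "(s, qs) \<in> inst21 k (map f \<pi>) \<longleftrightarrow> (s, qs) \<in> inst21 k \<pi>" for s qs
    using *[of "Suc s # s # qs"]
    by (auto simp: inst21_def simp del: list.map(2) sorted_wrt.simps(2))
  then show ?thesis by auto
qed

lemma sorted_nth_append_left:
  assumes "set ps \<subseteq> {..<length \<pi>}"
  shows "sorted_wrt (<) (map (nth (\<pi> @ \<rho>)) ps) \<longleftrightarrow> sorted_wrt (<) (map (nth \<pi>) ps)"
proof -
  have "map (nth (\<pi> @ \<rho>)) ps = map (nth \<pi>) ps"
    using assms by (auto simp: nth_append)
  then show ?thesis by metis
qed

lemma inst21_append_left:
  "(s, qs) \<in> inst21 k \<pi> \<longleftrightarrow> (s, qs) \<in> inst21 k (\<pi> @ \<rho>) \<and> Suc s < length \<pi> \<and> set qs \<subseteq> {..<length \<pi>}"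
  using sorted_nth_append_left[of "Suc s # s # qs" \<pi> \<rho>]
  by (auto simp: inst21_def simp del: list.map(2) sorted_wrt.simps(2))

text \<open>The occurrences are split by whether they use the last position. The letter
  \<open>m\<close> is the largest and stands last, so it can only be the final letter of a pattern
  with \<open>k > 0\<close>; deleting it leaves an occurrence of the pattern shorter by one
  letter.\<close>

lemma card_inst21_snoc:
  assumes m: "\<And>x. x \<in> set \<pi> \<Longrightarrow> x < m"
  shows "card (inst21 k (\<pi> @ [m])) =
     card (inst21 k \<pi>) + (if k = 0 then 0 else card (inst21 (k - 1) \<pi>))"
proof -
  let ?n = "length \<pi>"
  let ?e = "\<lambda>(s, qs). (s, qs @ [?n])"
  let ?X = "if k = 0 then {} else ?e ` inst21 (k - 1) \<pi>"
  have vals: "sorted_wrt (<) (map (nth (\<pi> @ [m])) (ps @ [?n])) \<longleftrightarrow>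
      sorted_wrt (<) (map (nth \<pi>) ps)" if "set ps \<subseteq> {..<?n}" for ps
    using that m sorted_nth_append_left[OF that] by (auto simp: sorted_wrt_append nth_append subset_iff)
  have "inst21 k (\<pi> @ [m]) \<subseteq> inst21 k \<pi> \<union> ?X"
  proof clarify
    fix s qs assume in_i: "(s, qs) \<in> inst21 k (\<pi> @ [m])" and notX: "(s, qs) \<notin> ?X"
    then have s: "Suc s < ?n"
    proof -
      have "Suc s \<noteq> ?n"
      proof
        assume "Suc s = ?n"
        then have "m < \<pi> ! s" "\<pi> ! s \<in> set \<pi>" using in_i by (auto simp: inst21_def nth_append)
        then show False using m by fastforce
      qed
      then show ?thesis using in_i by (auto simp: inst21_def)
    qed
    have "set qs \<subseteq> {..<?n}"
    proof (cases qs rule: rev_cases)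
      case (snoc q a)
      then have q: "set q \<subseteq> {..<?n}" and a: "a \<le> ?n"
        using in_i by (auto simp: inst21_def sorted_wrt_append)
      show ?thesis
      proof (cases "a = ?n")
        case True
        have "(s, q) \<in> inst21 (k - 1) \<pi>"
          using in_i s q vals[of "Suc s # s # q"] True unfolding snoc inst21_def
          by (auto simp: sorted_wrt_append[of "(<)" q] simp del: list.map(2) map_append)
        moreover have "k \<noteq> 0" using in_i snoc by (auto simp: inst21_def)
        ultimately show ?thesis using notX snoc True by force
      qed (use q a snoc in auto)
    qed simp
    then show "(s, qs) \<in> inst21 k \<pi>" using inst21_append_left in_i s by blast
  qed
  moreover have "?X \<subseteq> inst21 k (\<pi> @ [m])"
  proof (cases k)
    case (Suc k')
    have "(s, q @ [?n]) \<in> inst21 k (\<pi> @ [m])" if "(s, q) \<in> inst21 k' \<pi>" for s q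
      using that vals[of "Suc s # s # q"] Suc
      by (auto simp: inst21_def sorted_wrt_append[of "(<)" q] less_SucI subset_iff
            simp del: list.map(2) map_append)
    then show ?thesis using Suc by auto
  qed simp
  moreover have "inst21 k \<pi> \<subseteq> inst21 k (\<pi> @ [m])" using inst21_append_left by fast
  ultimately have eq: "inst21 k (\<pi> @ [m]) = inst21 k \<pi> \<union> ?X" by blast
  have "?n \<notin> set (snd p)" if "p \<in> inst21 k \<pi>" for p
    using that by (auto simp: inst21_def)
  moreover have "?n \<in> set (snd p)" if "p \<in> ?X" for p
    using that by (auto split: if_splits)
  ultimately have "inst21 k \<pi> \<inter> ?X = {}" by blast
  moreover have "card ?X = (if k = 0 then 0 else card (inst21 (k - 1) \<pi>))"
    by (auto intro!: card_image simp: inj_on_def)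
  ultimately show ?thesis
    unfolding eq by (subst card_Un_disjoint) (auto simp: finite_inst21)
qed

text \<open>If the 2 lies in \<open>\<rho>\<close>, so does everything after it. If it lies in
  \<open>\<tau>\<close>, the letters 3, 4, ... exceed it and cannot come from \<open>\<rho>\<close>.
  Only the 1 can cross the border, and then no position in \<open>\<tau>\<close> is left for further
  letters; so the one mixed occurrence is the descent from \<open>last \<tau>\<close> to
  \<open>hd \<rho>\<close>.\<close>

lemma card_inst21_append:
  assumes gt: "\<And>x y. x \<in> set \<tau> \<Longrightarrow> y \<in> set \<rho> \<Longrightarrow> y < x" and ne: "\<tau> \<noteq> []" "\<rho> \<noteq> []"
  shows "card (inst21 k (\<tau> @ \<rho>)) =
     card (inst21 k \<tau>) + card (inst21 k \<rho>) + (if k = 0 then 1 else 0)"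
proof -
  let ?n = "length \<tau>"
  let ?e = "\<lambda>(s, qs). (s + ?n, map (\<lambda>q. q + ?n) qs)"
  let ?X = "?e ` inst21 k \<rho>"
  let ?Y = "if k = 0 then {(?n - 1, [])} else {}"
  have shift: "(s + ?n, map (\<lambda>q. q + ?n) qs) \<in> inst21 k (\<tau> @ \<rho>) \<longleftrightarrow> (s, qs) \<in> inst21 k \<rho>" for s qs
  proof -
    have v: "(\<tau> @ \<rho>) ! (q + ?n) = \<rho> ! q" for q by (simp add: nth_append)
    have "(\<tau> @ \<rho>) ! (Suc (s + ?n)) = \<rho> ! Suc s" using v[of "Suc s"] by simp
    then show ?thesis
      by (auto simp: inst21_def sorted_wrt_map v comp_def)
  qed
  have "inst21 k (\<tau> @ \<rho>) \<subseteq> inst21 k \<tau> \<union> ?X \<union> ?Y"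
  proof clarify
    fix s qs assume in_i: "(s, qs) \<in> inst21 k (\<tau> @ \<rho>)" and notX: "(s, qs) \<notin> ?X"
      and notY: "(s, qs) \<notin> ?Y"
    have s: "s < ?n"
    proof (rule ccontr)
      assume "\<not> s < ?n"
      then obtain t where t: "s = t + ?n" by (metis add.commute le_Suc_ex not_less)
      have "\<forall>q\<in>set qs. ?n \<le> q" using in_i t by (auto simp: inst21_def)
      then have "qs = map (\<lambda>q. q + ?n) (map (\<lambda>q. q - ?n) qs)"
        by (simp add: map_idI)
      then show False using in_i notX shift t by (metis (no_types, lifting) case_prod_conv image_eqI)
    qed
    have qs: "set qs \<subseteq> {..<?n}"
    proof
      fix q assume q: "q \<in> set qs"
      have "q < ?n"
      proof (rule ccontr)
        assume "\<not> q < ?n"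
        then have "(\<tau> @ \<rho>) ! q \<in> set \<rho>" "(\<tau> @ \<rho>) ! s \<in> set \<tau>"
          using in_i s q by (auto simp: inst21_def nth_append subset_iff)
        moreover have "(\<tau> @ \<rho>) ! s < (\<tau> @ \<rho>) ! q" using in_i q by (auto simp: inst21_def)
        ultimately show False using gt by fastforce
      qed
      then show "q \<in> {..<?n}" by simp
    qed
    have "Suc s \<noteq> ?n"
    proof
      assume ss: "Suc s = ?n"
      then have "qs = []" using in_i qs by (cases qs) (auto simp: inst21_def)
      then show False using in_i notY ss by (auto simp: inst21_def)
    qed
    then show "(s, qs) \<in> inst21 k \<tau>" using inst21_append_left in_i s qs by (metis Suc_lessI)
  qed
  moreover have "?X \<subseteq> inst21 k (\<tau> @ \<rho>)" using shift by auto
  moreover have "?Y \<subseteq> inst21 k (\<tau> @ \<rho>)"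
    using gt ne by (auto simp: inst21_def nth_append)
  moreover have "inst21 k \<tau> \<subseteq> inst21 k (\<tau> @ \<rho>)" using inst21_append_left by fast
  ultimately have eq: "inst21 k (\<tau> @ \<rho>) = inst21 k \<tau> \<union> ?X \<union> ?Y" by blast
  have lt: "Suc (fst p) < ?n" if "p \<in> inst21 k \<tau>" for p
    using that by (auto simp: inst21_def)
  have ge: "?n \<le> fst p" if "p \<in> ?X" for p
    using that by auto
  have mid: "Suc (fst p) = ?n" if "p \<in> ?Y" for p
    using that ne by (auto split: if_splits)
  have disj: "inst21 k \<tau> \<inter> ?X = {}" "(inst21 k \<tau> \<union> ?X) \<inter> ?Y = {}"
  proof -
    have False if "p \<in> inst21 k \<tau>" "p \<in> ?X" for p
      using lt[OF that(1)] ge[OF that(2)] by simp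
    moreover have False if "p \<in> inst21 k \<tau>" "p \<in> ?Y" for p
      using lt[OF that(1)] mid[OF that(2)] by simp
    moreover have False if "p \<in> ?X" "p \<in> ?Y" for p
      using ge[OF that(1)] mid[OF that(2)] by simp
    ultimately show "inst21 k \<tau> \<inter> ?X = {}" "(inst21 k \<tau> \<union> ?X) \<inter> ?Y = {}"
      by blast+
  qed
  have "card ?X = card (inst21 k \<rho>)"
    by (rule card_image) (auto simp: inj_on_def inj_map_eq_map inj_def)
  then show ?thesis
    unfolding eq using disj by (simp add: card_Un_disjoint finite_inst21)
qed

section \<open>Weights of words\<close>

definition weight :: "(nat \<Rightarrow> 'a::field_char_0) \<Rightarrow> nat list \<Rightarrow> 'a" where
  "weight x \<pi> = (\<Prod>j=2..length \<pi>. x j ^ occ (pat21 j) \<pi>)"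

text \<open>Longer patterns contribute the factor 1. A common bound \<open>N\<close> allows weights
  of words of different lengths to be compared factor by factor.\<close>

lemma weight_eq_prod:
  assumes "length \<pi> \<le> N + 2"
  shows "weight x \<pi> = (\<Prod>k\<le>N. x (k + 2) ^ card (inst21 k \<pi>))"
proof -
  have "weight x \<pi> = (\<Prod>j=2..N + 2. x j ^ occ (pat21 j) \<pi>)"
    unfolding weight_def using assms by (intro prod.mono_neutral_left) (auto simp: occ_pat21_long)
  also have "\<dots> = (\<Prod>k=0..N. x (k + 2) ^ occ (pat21 (k + 2)) \<pi>)"
    using prod.shift_bounds_cl_nat_ivl[of "\<lambda>j. x j ^ occ (pat21 j) \<pi>" 0 2 N] by (simp only: add_0)
  finally show ?thesis by (simp only: occ_pat21 atLeast0AtMost)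
qed

lemma weight_map_strict_mono: "strict_mono f \<Longrightarrow> weight x (map f \<pi>) = weight x \<pi>"
  by (simp add: weight_eq_prod[of _ "length \<pi>"] inst21_map)

text \<open>For \<open>j \<ge> 3\<close> the exponent of \<open>x j\<close> grows by the count of
  the pattern of length \<open>j - 1\<close> in \<open>\<pi>\<close>. Regrouped by the counts in
  \<open>\<pi>\<close>, each occurrence of the pattern of length \<open>j\<close> yields
  \<open>x j * x (j + 1)\<close>.\<close>

lemma weight_snoc:
  assumes "\<And>y. y \<in> set \<pi> \<Longrightarrow> y < m"
  shows "weight x (\<pi> @ [m]) = weight (\<lambda>j. x j * x (j + 1)) \<pi>"
proof -
  let ?N = "length \<pi>" and ?c = "\<lambda>k. card (inst21 k \<pi>)"
  \<comment> \<open>The pattern has length \<open>?N + 3\<close>, so the top factor of the first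
    product below is 1.\<close>
  have 0: "?c (Suc ?N) = 0"
    using occ_pat21_long[of \<pi> "Suc ?N + 2"] by (simp only: occ_pat21)
  have "weight x (\<pi> @ [m]) = (\<Prod>k\<le>Suc ?N. x (k + 2) ^ (?c k + (if k = 0 then 0 else ?c (k - 1))))"
    by (subst weight_eq_prod[where N = "Suc ?N"]) (simp_all only: card_inst21_snoc[OF assms], auto)
  also have "\<dots> = (\<Prod>k\<le>Suc ?N. x (k + 2) ^ ?c k) *
                  (\<Prod>k\<le>Suc ?N. x (k + 2) ^ (if k = 0 then 0 else ?c (k - 1)))"
    by (simp only: power_add prod.distrib)
  also have "(\<Prod>k\<le>Suc ?N. x (k + 2) ^ ?c k) = (\<Prod>k\<le>?N. x (k + 2) ^ ?c k)"
    using 0 by simp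
  also have "(\<Prod>k\<le>Suc ?N. x (k + 2) ^ (if k = 0 then 0 else ?c (k - 1))) =
             (\<Prod>k\<le>?N. x (k + 2 + 1) ^ ?c k)"
    by (subst prod.atMost_Suc_shift) simp
  also have "(\<Prod>k\<le>?N. x (k + 2) ^ ?c k) * (\<Prod>k\<le>?N. x (k + 2 + 1) ^ ?c k) =
             weight (\<lambda>j. x j * x (j + 1)) \<pi>"
    by (simp add: weight_eq_prod[where N = ?N] power_mult_distrib prod.distrib)
  finally show ?thesis .
qed

lemma weight_append:
  assumes "\<And>y z. y \<in> set \<tau> \<Longrightarrow> z \<in> set \<rho> \<Longrightarrow> z < y" and "\<tau> \<noteq> []" "\<rho> \<noteq> []"
  shows "weight x (\<tau> @ \<rho>) = x 2 * weight x \<tau> * weight x \<rho>"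
proof -
  define N where "N = length (\<tau> @ \<rho>)"
  have "weight x (\<tau> @ \<rho>) = (\<Prod>k\<le>N. x (k + 2) ^ card (inst21 k \<tau>)) *
      (\<Prod>k\<le>N. x (k + 2) ^ card (inst21 k \<rho>)) * (\<Prod>k\<le>N. if k = 0 then x (k + 2) else 1)"
    unfolding prod.distrib[symmetric]
    by (subst weight_eq_prod[where N = N])
      (auto simp: N_def card_inst21_append[OF assms] power_add simp del: prod.delta
        intro!: prod.cong)
  also have "(\<Prod>k\<le>N. if k = 0 then x (k + 2) else 1) = x 2"
    by (simp add: numeral_2_eq_2)
  finally show ?thesis
    by (simp add: weight_eq_prod[where N = N] N_def)
qed

section \<open>The Dumont condition and avoidance of 1-3-2 in recursive form\<close>

definition dstep :: "nat \<Rightarrow> nat \<Rightarrow> bool" where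
  "dstep a b \<longleftrightarrow> (if even a then b < a else a < b)"

text \<open>Every position but the last constrains only an adjacent pair; at the last one an even
  letter would lack its smaller successor.\<close>

lemma dumont_altdef: "dumont \<pi> \<longleftrightarrow> successively dstep \<pi> \<and> (\<pi> \<noteq> [] \<longrightarrow> odd (last \<pi>))"
proof (induction \<pi> rule: induct_list012)
  case (3 a b \<pi>)
  have "dumont (a # b # \<pi>) \<longleftrightarrow> dstep a b \<and> dumont (b # \<pi>)"
    unfolding dumont_def dstep_def length_Cons All_less_Suc2 by auto
  then show ?case using 3 by auto
qed (auto simp: dumont_def)

text \<open>An occurrence either uses the head as its 1 or lies in the tail; this recursion suits
  append and map.\<close>

fun avoids132 :: "nat list \<Rightarrow> bool" where
  "avoids132 [] = True"
| "avoids132 (a # \<pi>) \<longleftrightarrow> sorted_wrt (\<lambda>b c. \<not> (a < c \<and> c < b)) \<pi> \<and> avoids132 \<pi>"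

lemma avoids132_nth:
  "avoids132 \<pi> \<longleftrightarrow>
     (\<forall>i j k. i < j \<longrightarrow> j < k \<longrightarrow> k < length \<pi> \<longrightarrow> \<not> (\<pi> ! i < \<pi> ! k \<and> \<pi> ! k < \<pi> ! j))"
proof (induction \<pi>)
  case (Cons a \<pi>)
  show ?case (is "_ \<longleftrightarrow> (\<forall>i j k. ?P i j k)")
  proof
    assume L: "avoids132 (a # \<pi>)"
    show "\<forall>i j k. ?P i j k"
    proof (intro allI impI)
      fix i j k assume ijk: "i < j" "j < k" "k < length (a # \<pi>)"
      then obtain j' k' where "j = Suc j'" "k = Suc k'" by (metis gr0_implies_Suc less_zeroE not_gr0)
      with ijk L Cons show "\<not> ((a # \<pi>) ! i < (a # \<pi>) ! k \<and> (a # \<pi>) ! k < (a # \<pi>) ! j)"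
        by (cases i) (auto simp: sorted_wrt_iff_nth_less)
    qed
  next
    assume R: "\<forall>i j k. ?P i j k"
    have "sorted_wrt (\<lambda>b c. \<not> (a < c \<and> c < b)) \<pi>"
      unfolding sorted_wrt_iff_nth_less using R[rule_format, of 0 "Suc _" "Suc _"] by auto
    moreover have "avoids132 \<pi>"
      unfolding Cons using R[rule_format, of "Suc _" "Suc _" "Suc _"] by auto
    ultimately show "avoids132 (a # \<pi>)" by simp
  qed
qed simp

lemma avoids132_iff: "avoids \<pi> [[1], [3], [2]] \<longleftrightarrow> avoids132 \<pi>"
proof -
  have blocks: "(\<exists>ss. length ss = length [[1], [3], [2::nat]] \<and>
      ps = concat (map2 (\<lambda>s b. [s..<s + length b]) ss [[1], [3], [2::nat]]))
      \<longleftrightarrow> (\<exists>i j k. ps = [i, j, k])" for ps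
  proof
    assume "\<exists>i j k. ps = [i, j, k]"
    then obtain i j k where "ps = [i, j, k]" by blast
    then show "\<exists>ss. length ss = length [[1], [3], [2::nat]] \<and>
        ps = concat (map2 (\<lambda>s b. [s..<s + length b]) ss [[1], [3], [2::nat]])"
      by (intro exI[of _ "[i, j, k]"]) simp
  qed (auto simp: length_Suc_conv)
  have "occurrences [[1], [3], [2]] \<pi> =
      {ps. \<exists>i j k. ps = [i, j, k] \<and> i < j \<and> j < k \<and> k < length \<pi> \<and> \<pi> ! i < \<pi> ! k \<and> \<pi> ! k < \<pi> ! j}"
    unfolding occurrences_def blocks by (auto simp: less_Suc_eq numeral_3_eq_3 numeral_2_eq_2)
  then show ?thesis unfolding avoids_def avoids132_nth by auto
qed

text \<open>The conjuncts classify a triple by how many of its letters lie in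
  \<open>\<sigma>\<close>: three, none, one, two.\<close>

lemma avoids132_append:
  "avoids132 (\<sigma> @ \<rho>) \<longleftrightarrow> avoids132 \<sigma> \<and> avoids132 \<rho> \<and>
     (\<forall>a\<in>set \<sigma>. sorted_wrt (\<lambda>b c. \<not> (a < c \<and> c < b)) \<rho>) \<and>
     (\<forall>c\<in>set \<rho>. sorted_wrt (\<lambda>a b. \<not> (a < c \<and> c < b)) \<sigma>)"
  by (induction \<sigma>) (auto simp: sorted_wrt_append)

lemma sorted_wrt_if_all:
  "(\<And>a b. a \<in> set xs \<Longrightarrow> b \<in> set xs \<Longrightarrow> P a b) \<Longrightarrow> sorted_wrt P xs"
  by (induction xs) auto

text \<open>Taking \<open>m\<close> as the 3 forces every letter before it above every letter after
  it. Conversely, this order excludes an occurrence with its 1 in \<open>\<sigma>\<close> and its 2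
  in \<open>\<rho>\<close>, and \<open>m\<close> can be neither 1 nor 2.\<close>

lemma avoids132_split_max:
  assumes "\<And>y. y \<in> set \<sigma> \<union> set \<rho> \<Longrightarrow> y < m" "set \<sigma> \<inter> set \<rho> = {}"
  shows "avoids132 (\<sigma> @ m # \<rho>) \<longleftrightarrow>
     avoids132 \<sigma> \<and> avoids132 \<rho> \<and> (\<forall>a\<in>set \<sigma>. \<forall>c\<in>set \<rho>. c < a)"
proof -
  have "\<forall>y\<in>set \<sigma> \<union> set \<rho>. \<not> m < y"
    using assms(1) by (meson less_asym)
  then have triv: "sorted_wrt (\<lambda>b c. \<not> (m < c \<and> c < b)) \<rho>"
    "sorted_wrt (\<lambda>a b. \<not> (a < m \<and> m < b)) \<sigma>"
    by (auto intro!: sorted_wrt_if_all)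
  have "sorted_wrt (\<lambda>b c. \<not> (a < c \<and> c < b)) \<rho>" if "\<forall>c\<in>set \<rho>. c < a" for a
    using that by (intro sorted_wrt_if_all) (meson less_asym)
  moreover have "sorted_wrt (\<lambda>a b. \<not> (a < c \<and> c < b)) \<sigma>" if "\<forall>a\<in>set \<sigma>. c < a" for c
    using that by (intro sorted_wrt_if_all) (meson less_asym)
  \<comment> \<open>Disjointness gives \<open>a \<noteq> c\<close>, and \<open>c < m\<close> always
    holds.\<close>
  moreover have "\<forall>a\<in>set \<sigma>. \<forall>c\<in>set \<rho>. c < a \<longleftrightarrow> \<not> (a < c \<and> c < m)"
    using assms by (metis disjoint_iff Un_iff linorder_neqE_nat less_asym)
  ultimately show ?thesis
    using triv by (auto simp: avoids132_append)
qed

lemma avoids132_map: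
  assumes "strict_mono f"
  shows "avoids132 (map f \<pi>) \<longleftrightarrow> avoids132 \<pi>"
  by (induction \<pi>) (simp_all add: sorted_wrt_map strict_mono_less[OF assms])

section \<open>Decomposition at the largest letter\<close>

definition D132 :: "nat \<Rightarrow> nat list set" where
  "D132 n = {\<pi> \<in> permutations_of_set {1..n}. dumont \<pi> \<and> avoids132 \<pi>}"

lemma dumont_avoid_132_length: "{\<pi>. \<pi> \<in> dumont_avoid_132 \<and> length \<pi> = n} = D132 n"
proof -
  have "length \<pi> = m" if "\<pi> \<in> permutations_of_set {1..m}" for \<pi> :: "nat list" and m
    using length_finite_permutations_of_set[OF that] by simp
  then show ?thesis unfolding dumont_avoid_132_def D132_def avoids132_iff by blast
qed

lemma finite_D132: "finite (D132 n)"
  by (simp add: D132_def)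

lemma D132_iff:
  "\<pi> \<in> D132 n \<longleftrightarrow> set \<pi> = {1..n} \<and> distinct \<pi> \<and> successively dstep \<pi> \<and>
     (\<pi> \<noteq> [] \<longrightarrow> odd (last \<pi>)) \<and> avoids132 \<pi>"
  by (auto simp: D132_def permutations_of_set_def dumont_altdef)

lemma D132_length: "\<pi> \<in> D132 n \<Longrightarrow> length \<pi> = n"
  by (metis D132_iff card_atLeastAtMost diff_Suc_1 distinct_card)

lemma D132_0: "D132 0 = {[]}"
  by (auto simp: D132_iff)

text \<open>\<open>k\<close> is the largest element of \<open>Q\<close>, or 0 if \<open>Q\<close> is
  empty. Elements of \<open>P\<close> exceed \<open>k\<close>, so all of \<open>{1..k}\<close> must
  lie in \<open>Q\<close>.\<close>

lemma skew_split_interval: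
  fixes P Q :: "nat set"
  assumes un: "P \<union> Q = {1..n}" and gt: "\<And>a c. a \<in> P \<Longrightarrow> c \<in> Q \<Longrightarrow> c < a"
  obtains k where "k \<le> n" "Q = {1..k}" "P = {k+1..n}"
proof (cases "Q = {}")
  case True
  then show ?thesis using that[of 0] un by auto
next
  case False
  have fin: "finite Q" using un by (metis finite_Un finite_atLeastAtMost)
  define k where "k = Max Q"
  have k: "k \<in> Q" "\<And>c. c \<in> Q \<Longrightarrow> c \<le> k" using False fin by (auto simp: k_def)
  have "k \<in> {1..n}" using k un by blast
  have Q: "Q = {1..k}"
  proof
    show "Q \<subseteq> {1..k}" using k un by auto
    show "{1..k} \<subseteq> Q"
    proof
      fix c assume c: "c \<in> {1..k}"
      then have "c \<in> P \<union> Q" using \<open>k \<in> {1..n}\<close> un by auto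
      then show "c \<in> Q" using gt k c by fastforce
    qed
  qed
  have "P = {k+1..n}"
  proof
    show "P \<subseteq> {k+1..n}" using gt k un by fastforce
    show "{k+1..n} \<subseteq> P" using un Q by fastforce
  qed
  then show ?thesis using that Q \<open>k \<in> {1..n}\<close> by auto
qed

lemma successively_dstep_shift:
  "even k \<Longrightarrow> successively dstep (map (\<lambda>y. y + k) \<pi>) \<longleftrightarrow> successively dstep \<pi>"
  by (simp add: successively_map dstep_def cong: if_cong)

text \<open>The maximum \<open>Suc n\<close> has no larger successor, so it stands last if odd and
  cannot if even; hence \<open>even n \<longleftrightarrow> k = 0\<close>. By
  \<open>even k \<or> k = n\<close>, the shift by \<open>k\<close> preserves parities unless there
  is nothing to shift.\<close>

lemma D132_split_max:
  assumes "\<pi> \<in> D132 (Suc n)"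
  obtains k \<sigma> \<rho> where "k \<le> n" "\<pi> = map (\<lambda>y. y + k) \<sigma> @ Suc n # \<rho>"
    "\<sigma> \<in> D132 (n - k)" "\<rho> \<in> D132 k" "even k \<or> k = n" "even n \<longleftrightarrow> k = 0"
proof -
  have \<pi>: "set \<pi> = {1..Suc n}" "distinct \<pi>" "successively dstep \<pi>" "\<pi> \<noteq> [] \<longrightarrow> odd (last \<pi>)"
    "avoids132 \<pi>" using assms by (auto simp: D132_iff)
  have "Suc n \<in> set \<pi>" using \<pi> by simp
  then obtain \<tau> \<rho> where split: "\<pi> = \<tau> @ Suc n # \<rho>" by (metis split_list)
  have un: "set \<tau> \<union> set \<rho> = {1..n}"
  proof -
    have "set \<tau> \<union> set \<rho> = set \<pi> - {Suc n}" using \<pi>(2) split by auto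
    also have "\<dots> = {1..n}" unfolding \<pi>(1) by auto
    finally show ?thesis .
  qed
  have max: "y < Suc n" if "y \<in> set \<tau> \<union> set \<rho>" for y
    using that un by auto
  have disj: "set \<tau> \<inter> set \<rho> = {}" using \<pi>(2) split by auto
  have av: "avoids132 \<tau>" "avoids132 \<rho>" "\<forall>a\<in>set \<tau>. \<forall>c\<in>set \<rho>. c < a"
    using \<pi>(5) avoids132_split_max[OF max disj] by (auto simp: split)
  obtain k where k: "k \<le> n" "set \<rho> = {1..k}" "set \<tau> = {k+1..n}"
    using skew_split_interval[OF un] av(3) by blast
  have suc: "successively dstep \<tau>" "successively dstep \<rho>"
    "\<tau> \<noteq> [] \<Longrightarrow> dstep (last \<tau>) (Suc n)" "\<rho> \<noteq> [] \<Longrightarrow> dstep (Suc n) (hd \<rho>)"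
    using \<pi>(3) by (auto simp: split successively_append_iff successively_Cons)
  have last_\<rho>: "\<rho> \<noteq> [] \<Longrightarrow> odd (last \<rho>)" "\<rho> = [] \<Longrightarrow> odd (Suc n)"
    using \<pi>(4) split by auto
  have \<rho>: "\<rho> \<in> D132 k"
    using k av suc last_\<rho> \<pi>(2) split by (auto simp: D132_iff)
  \<comment> \<open>The maximum follows \<open>last \<tau>\<close>, and an ascent starts with an odd
    letter.\<close>
  have last_\<tau>: "odd (last \<tau>)" if "\<tau> \<noteq> []"
    using suc(3)[OF that] max[of "last \<tau>"] that by (auto simp: dstep_def split: if_splits)
  \<comment> \<open>Otherwise \<open>k + 1\<close>, the least letter of \<open>\<tau>\<close>, is
    even. It is not the last letter of \<open>\<tau>\<close>, so a smaller letter of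
    \<open>\<tau>\<close> would have to follow it.\<close>
  have k_even: "even k \<or> k = n"
  proof (rule ccontr)
    assume "\<not> (even k \<or> k = n)"
    then have "even (k + 1)" "k + 1 \<in> set \<tau>" using k by auto
    then obtain u v where uv: "\<tau> = u @ (k + 1) # v" by (metis split_list)
    then have "v \<noteq> []" using last_\<tau> \<open>even (k + 1)\<close> by fastforce
    then obtain b w where "v = b # w" by (cases v) auto
    then have "dstep (k + 1) b" "b \<in> set \<tau>"
      using suc(1) uv by (auto simp: successively_append_iff)
    then show False using \<open>even (k + 1)\<close> k by (auto simp: dstep_def)
  qed
  have k0: "even n \<longleftrightarrow> k = 0"
  proof (cases "\<rho> = []")
    case True
    then show ?thesis using k last_\<rho> by auto
  next
    case False
    then have "hd \<rho> < Suc n" using max[of "hd \<rho>"] by auto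
    then have "odd n" using suc(4)[OF False] by (auto simp: dstep_def split: if_splits)
    moreover have "k \<noteq> 0" using False k(2) by (metis atLeastatMost_empty_iff2 not_one_le_zero set_empty)
    ultimately show ?thesis by simp
  qed
  define \<sigma> where "\<sigma> = map (\<lambda>y. y - k) \<tau>"
  have \<tau>: "\<tau> = map (\<lambda>y. y + k) \<sigma>"
    using k by (auto simp: \<sigma>_def intro!: map_idI[symmetric])
  have "\<sigma> \<in> D132 (n - k)"
  proof (cases "even k")
    case True
    have "set \<sigma> = {1..n - k}"
    proof -
      have "(\<lambda>y. y + k) ` set \<sigma> = (\<lambda>y. y + k) ` {1..n - k}"
        using \<tau> k by (simp add: add.commute flip: set_map)
      then show ?thesis by (subst (asm) inj_image_eq_iff) (auto simp: inj_def)
    qed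
    moreover have "distinct \<sigma>" using \<pi>(2) split \<tau> by (auto simp: distinct_map)
    moreover have "successively dstep \<sigma>"
      using suc(1) \<tau> successively_dstep_shift[OF True] by simp
    moreover have "\<sigma> \<noteq> [] \<longrightarrow> odd (last \<sigma>)"
      using last_\<tau> True \<tau> by (auto simp: last_map)
    moreover have "avoids132 \<sigma>"
      using av(1) \<tau> avoids132_map[of "\<lambda>y. y + k" \<sigma>] by (simp add: strict_mono_def)
    ultimately show ?thesis by (simp add: D132_iff)
  next
    case False
    \<comment> \<open>An odd \<open>k\<close> equals \<open>n\<close>, so \<open>\<tau>\<close> and
      \<open>\<sigma>\<close> are empty.\<close>
    then show ?thesis using k_even k by (simp add: \<sigma>_def D132_0)
  qed
  then show ?thesis using that[OF k(1) _ _ \<rho> k_even k0] split \<tau> by blast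
qed

text \<open>The parity conditions serve the junctions: an even shift keeps the letter before the
  maximum odd, and the maximum is followed by a smaller letter only if \<open>Suc n\<close> is
  even.\<close>

lemma D132_join:
  assumes "k \<le> n" "\<sigma> \<in> D132 (n - k)" "\<rho> \<in> D132 k" "even k \<or> k = n" "even n \<longleftrightarrow> k = 0"
  shows "map (\<lambda>y. y + k) \<sigma> @ Suc n # \<rho> \<in> D132 (Suc n)"
proof -
  let ?\<tau> = "map (\<lambda>y. y + k) \<sigma>"
  have \<sigma>: "set \<sigma> = {1..n - k}" "distinct \<sigma>" "successively dstep \<sigma>" "\<sigma> \<noteq> [] \<longrightarrow> odd (last \<sigma>)"
    "avoids132 \<sigma>" using assms(2) by (auto simp: D132_iff)
  have \<rho>: "set \<rho> = {1..k}" "distinct \<rho>" "successively dstep \<rho>" "\<rho> \<noteq> [] \<longrightarrow> odd (last \<rho>)"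
    "avoids132 \<rho>" using assms(3) by (auto simp: D132_iff)
  have set\<tau>: "set ?\<tau> = {k + 1..n}"
    using \<sigma>(1) assms(1) by (simp add: add.commute)
  have k_even: "even k" if "\<sigma> \<noteq> []" using that assms \<sigma> by auto
  have "set (?\<tau> @ Suc n # \<rho>) = {1..Suc n}" using set\<tau> \<rho>(1) assms(1) by auto
  moreover have "distinct (?\<tau> @ Suc n # \<rho>)"
    using set\<tau> \<rho>(1,2) \<sigma>(2) assms(1) by (auto simp: distinct_map)
  moreover have "successively dstep (?\<tau> @ Suc n # \<rho>)"
  proof -
    have "successively dstep ?\<tau>"
      using \<sigma>(3) successively_dstep_shift[OF k_even] by (cases "\<sigma> = []") auto
    moreover have "dstep (last ?\<tau>) (Suc n)" if "\<sigma> \<noteq> []"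
    proof -
      have "last ?\<tau> \<in> set ?\<tau>" using that by (intro last_in_set) simp
      then show ?thesis
        unfolding set\<tau> using that \<sigma>(4) k_even[OF that] by (auto simp: dstep_def last_map)
    qed
    moreover have "dstep (Suc n) (hd \<rho>)" if "\<rho> \<noteq> []"
      using that hd_in_set[OF that] \<rho>(1) assms by (auto simp: dstep_def)
    ultimately show ?thesis using \<rho>(3) by (auto simp: successively_append_iff successively_Cons)
  qed
  moreover have "odd (last (?\<tau> @ Suc n # \<rho>))"
    using \<rho>(1,4) assms(5) by auto
  moreover have "avoids132 (?\<tau> @ Suc n # \<rho>)"
  proof (subst avoids132_split_max)
    show "avoids132 ?\<tau> \<and> avoids132 \<rho> \<and> (\<forall>a\<in>set ?\<tau>. \<forall>c\<in>set \<rho>. c < a)"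
      using \<sigma>(5) \<rho>(1,5) set\<tau> avoids132_map[of "\<lambda>y. y + k" \<sigma>] by (auto simp: strict_mono_def)
  qed (use set\<tau> \<rho>(1) assms(1) in auto)
  ultimately show ?thesis by (simp add: D132_iff)
qed

section \<open>Recurrences for the coefficients\<close>

definition coeff132 :: "(nat \<Rightarrow> 'a::field_char_0) \<Rightarrow> nat \<Rightarrow> 'a" where
  "coeff132 x n = (\<Sum>\<pi>\<in>D132 n. weight x \<pi>)"

lemma C_gf_nth: "C_gf x $ n = coeff132 x n"
  by (simp add: C_gf_def coeff132_def weight_def dumont_avoid_132_length)

lemma coeff132_0: "coeff132 x 0 = 1"
  by (simp add: coeff132_def D132_0 weight_def)

text \<open>For even \<open>n\<close> the decomposition has \<open>k = 0\<close>, so appending the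
  maximum is a bijection, and \<open>weight_snoc\<close> gives its effect on weights.\<close>

lemma coeff132_odd:
  assumes "even n"
  shows "coeff132 x (Suc n) = coeff132 (\<lambda>j. x j * x (j + 1)) n"
proof -
  have D: "D132 (Suc n) = (\<lambda>\<pi>. \<pi> @ [Suc n]) ` D132 n"
  proof (intro equalityI subsetI)
    fix \<pi> assume "\<pi> \<in> D132 (Suc n)"
    then obtain k \<sigma> \<rho> where "\<pi> = map (\<lambda>y. y + k) \<sigma> @ Suc n # \<rho>"
      "\<sigma> \<in> D132 (n - k)" "\<rho> \<in> D132 k" "even n \<longleftrightarrow> k = 0"
      by (rule D132_split_max)
    then show "\<pi> \<in> (\<lambda>\<pi>. \<pi> @ [Suc n]) ` D132 n" using assms by (auto simp: D132_0)
  next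
    fix \<pi> assume "\<pi> \<in> (\<lambda>\<pi>. \<pi> @ [Suc n]) ` D132 n"
    then show "\<pi> \<in> D132 (Suc n)"
      using D132_join[of 0 n _ "[]"] assms by (auto simp: D132_0)
  qed
  have "coeff132 x (Suc n) = (\<Sum>\<pi>\<in>D132 n. weight x (\<pi> @ [Suc n]))"
    unfolding coeff132_def D by (subst sum.reindex) (auto simp: inj_on_def)
  also have "\<dots> = coeff132 (\<lambda>j. x j * x (j + 1)) n"
    unfolding coeff132_def
    by (intro sum.cong refl weight_snoc) (auto simp: D132_iff)
  finally show ?thesis .
qed

text \<open>Here \<open>k\<close> is the size of \<open>\<rho>\<close>; the index
  \<open>k = n\<close> belongs to empty \<open>\<sigma>\<close>. The maximum, appended to the
  shifted \<open>\<sigma>\<close>, causes the substitution in the first factor, and the descent into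
  \<open>\<rho>\<close> gives \<open>x 2\<close>.\<close>

lemma coeff132_even:
  assumes "odd n"
  shows "coeff132 x (Suc n) = x 2 *
     (\<Sum>k\<in>insert n {k. even k \<and> 2 \<le> k \<and> k < n}.
        coeff132 (\<lambda>j. x j * x (j + 1)) (n - k) * coeff132 x k)"
proof -
  let ?K = "insert n {k. even k \<and> 2 \<le> k \<and> k < n}"
  let ?x' = "\<lambda>j. x j * x (j + 1)"
  let ?f = "\<lambda>(k, \<sigma>, \<rho>). map (\<lambda>y. y + k) \<sigma> @ Suc n # \<rho>"
  let ?S = "SIGMA k:?K. D132 (n - k) \<times> D132 k"
  have D: "D132 (Suc n) = ?f ` ?S"
  proof (intro equalityI subsetI)
    fix \<pi> assume "\<pi> \<in> D132 (Suc n)"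
    then obtain k \<sigma> \<rho> where k: "k \<le> n" "\<pi> = map (\<lambda>y. y + k) \<sigma> @ Suc n # \<rho>"
      "\<sigma> \<in> D132 (n - k)" "\<rho> \<in> D132 k" "even k \<or> k = n" "even n \<longleftrightarrow> k = 0"
      by (rule D132_split_max)
    \<comment> \<open>\<open>k\<close> is nonzero because \<open>n\<close> is odd, so an even
      \<open>k\<close> is at least 2.\<close>
    have "k \<in> ?K" using k assms by (cases "k = n") (auto simp: le_less elim!: evenE)
    then have "(k, \<sigma>, \<rho>) \<in> ?S" using k by simp
    moreover have "\<pi> = ?f (k, \<sigma>, \<rho>)" using k by simp
    ultimately show "\<pi> \<in> ?f ` ?S" by (rule rev_image_eqI)
  next
    fix \<pi> assume "\<pi> \<in> ?f ` ?S"
    then show "\<pi> \<in> D132 (Suc n)"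
      using assms by (auto intro!: D132_join)
  qed
  have inj: "inj_on ?f ?S"
  proof (intro inj_onI, clarify)
    fix k \<sigma> \<rho> k' \<sigma>' \<rho>'
    assume k: "k \<in> ?K" "\<sigma> \<in> D132 (n - k)" "\<rho> \<in> D132 k"
      and k': "k' \<in> ?K" "\<sigma>' \<in> D132 (n - k')" "\<rho>' \<in> D132 k'"
      and eq: "map (\<lambda>y. y + k) \<sigma> @ Suc n # \<rho> = map (\<lambda>y. y + k') \<sigma>' @ Suc n # \<rho>'"
    \<comment> \<open>As \<open>Suc n\<close> occurs only once, it marks the same cut in both words;
      the length of \<open>\<rho>\<close> then determines \<open>k\<close>.\<close>
    have "Suc n \<notin> set (map (\<lambda>y. y + k) \<sigma>)" "Suc n \<notin> set \<rho>"
      using k by (auto simp: D132_iff)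
    then have *: "map (\<lambda>y. y + k) \<sigma> = map (\<lambda>y. y + k') \<sigma>'" "\<rho> = \<rho>'"
      using eq by (simp_all add: append_Cons_eq_iff)
    then have "k = k'" using k k' D132_length by metis
    moreover have "\<sigma> = \<sigma>'" using * \<open>k = k'\<close> by (auto simp: inj_map_eq_map inj_def)
    ultimately show "k = k' \<and> (\<sigma>, \<rho>) = (\<sigma>', \<rho>')" using * by auto
  qed
  have w: "weight x (?f (k, \<sigma>, \<rho>)) = x 2 * (weight ?x' \<sigma> * weight x \<rho>)"
    if "k \<in> ?K" "\<sigma> \<in> D132 (n - k)" "\<rho> \<in> D132 k" for k \<sigma> \<rho>
  proof -
    have sets: "set (map (\<lambda>y. y + k) \<sigma>) \<subseteq> {k + 1..n}" "set \<rho> = {1..k}"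
      using that by (auto simp: D132_iff)
    have "k \<noteq> 0" "k \<le> n" using that(1) assms by (auto intro: Nat.gr0I)
    then have "\<rho> \<noteq> []" using sets by auto
    have "weight x ((map (\<lambda>y. y + k) \<sigma> @ [Suc n]) @ \<rho>) =
        x 2 * weight x (map (\<lambda>y. y + k) \<sigma> @ [Suc n]) * weight x \<rho>"
      using sets \<open>\<rho> \<noteq> []\<close> \<open>k \<le> n\<close> by (intro weight_append) auto
    also have "weight x (map (\<lambda>y. y + k) \<sigma> @ [Suc n]) = weight ?x' (map (\<lambda>y. y + k) \<sigma>)"
      using sets(1) by (intro weight_snoc) (meson atLeastAtMost_iff le_imp_less_Suc subsetD)
    also have "\<dots> = weight ?x' \<sigma>"
      by (intro weight_map_strict_mono) (simp add: strict_mono_def)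
    finally show ?thesis by (simp add: mult.assoc)
  qed
  have fin: "finite ?K" by simp
  have "coeff132 x (Suc n) = (\<Sum>p\<in>?S. weight x (?f p))"
    unfolding coeff132_def D by (subst sum.reindex[OF inj]) simp
  also have "\<dots> = (\<Sum>k\<in>?K. \<Sum>(\<sigma>, \<rho>)\<in>D132 (n - k) \<times> D132 k. weight x (?f (k, \<sigma>, \<rho>)))"
    by (subst sum.Sigma[OF fin]) (auto simp: finite_D132 split_def)
  also have "\<dots> = (\<Sum>k\<in>?K. \<Sum>(\<sigma>, \<rho>)\<in>D132 (n - k) \<times> D132 k. x 2 * (weight ?x' \<sigma> * weight x \<rho>))"
    using w by (intro sum.cong refl) auto
  also have "\<dots> = x 2 * (\<Sum>k\<in>?K. coeff132 ?x' (n - k) * coeff132 x k)"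
    unfolding coeff132_def sum_distrib_left[of "x 2"] sum_product sum.cartesian_product
    by (simp only: split_def)
  finally show ?thesis .
qed

section \<open>Passage to the generating functions\<close>

lemma C_gf_uminus_nth: "(C_gf x oo (- fps_X)) $ n = (- 1) ^ n * coeff132 x n"
proof -
  have "(- fps_X :: 'a fps) = fps_const (- 1) * fps_X" by (simp flip: fps_const_neg)
  then show ?thesis by (simp only: fps_compose_linear fps_nth_Abs_fps C_gf_nth)
qed

text \<open>The signs \<open>(- 1) ^ n\<close> cancel the odd coefficients and double the even
  ones.\<close>

lemma A3_nth: "A3 x $ n = (if even n then coeff132 x n else 0)"
  by (simp add: A3_def C_gf_nth C_gf_uminus_nth)

lemma B3_nth: "B3 x $ n = (if odd n then coeff132 x n else 0)"
  by (simp add: B3_def C_gf_nth C_gf_uminus_nth)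

lemma B3_eq: "B3 x = fps_X * A3 (\<lambda>j. x j * x (j + 1))"
proof (rule fps_ext)
  show "B3 x $ n = (fps_X * A3 (\<lambda>j. x j * x (j + 1))) $ n" for n
    by (cases n) (simp_all add: B3_nth A3_nth coeff132_odd)
qed

lemma fps_mult_divide_cancel:
  fixes f g :: "'a::field fps"
  assumes "g $ 0 \<noteq> 0"
  shows "f * g / g = f"
  using assms by (simp add: fps_divide_unit mult.assoc inverse_mult_eq_1')

text \<open>This is the first identity cleared of its denominator. In \<open>coeff132_even\<close>,
  the term for empty \<open>\<sigma>\<close> has an odd-size \<open>\<rho>\<close>, which
  \<open>coeff132_odd\<close> turns into the first summand. In the other terms
  \<open>A3 x - 1\<close> collects the nonempty \<open>\<rho>\<close> of even size, while the
  odd-size \<open>\<sigma>\<close> undergoes one substitution from the maximum and a second from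
  \<open>coeff132_odd\<close>.\<close>

lemma A3_recurrence:
  fixes x :: "nat \<Rightarrow> 'a::field_char_0"
  shows "A3 x - 1 = fps_X ^ 2 * fps_const (x 2) * A3 (\<lambda>j. x j * x (j + 1)) +
     fps_X ^ 2 * fps_const (x 2) * ((A3 x - 1) * A3 (\<lambda>j. x j * x (j + 1) ^ 2 * x (j + 2)))"
proof -
  let ?x1 = "\<lambda>j. x j * x (j + 1)"
  let ?x2 = "\<lambda>j. x j * x (j + 1) ^ 2 * x (j + 2)"
  have x2: "(\<lambda>j. ?x1 j * ?x1 (j + 1)) = ?x2"
    by (simp add: power2_eq_square mult.assoc)
  have "A3 x - 1 = fps_X ^ 2 * (fps_const (x 2) * (A3 ?x1 + (A3 x - 1) * A3 ?x2))"
  proof (rule fps_ext)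
    fix n
    show "(A3 x - 1) $ n = (fps_X ^ 2 * (fps_const (x 2) * (A3 ?x1 + (A3 x - 1) * A3 ?x2))) $ n"
    proof (cases "n < 2")
      case True
      then have "n = 0 \<or> n = 1" by auto
      \<comment> \<open>The right side vanishes by the factor \<open>fps_X ^ 2\<close>; on the left,
        1 removes the constant term and \<open>A3 x\<close> has no odd coefficients.\<close>
      then show ?thesis by (auto simp: A3_nth coeff132_0 fps_X_power_mult_nth)
    next
      case False
      then obtain m where n: "n = Suc (Suc m)" by (metis One_nat_def Suc_1 add_2_eq_Suc le_Suc_ex not_less)
      let ?K = "{k. even k \<and> 2 \<le> k \<and> k < Suc m}"
      have conv: "((A3 x - 1) * A3 ?x2) $ m =
          (if even m then \<Sum>k\<in>?K. coeff132 ?x2 (m - k) * coeff132 x k else 0)"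
      proof -
        have "((A3 x - 1) * A3 ?x2) $ m = (\<Sum>k=0..m. (A3 x - 1) $ k * A3 ?x2 $ (m - k))"
          by (rule fps_mult_nth)
        also have "\<dots> = (\<Sum>k\<in>?K. (A3 x - 1) $ k * A3 ?x2 $ (m - k))"
        proof (rule sum.mono_neutral_right)
          show "\<forall>k\<in>{0..m} - ?K. (A3 x - 1) $ k * A3 ?x2 $ (m - k) = 0"
          proof
            fix k assume "k \<in> {0..m} - ?K"
            \<comment> \<open>Odd \<open>k\<close> drops out by parity, and \<open>k = 0\<close>
              because of the subtracted 1.\<close>
            then have "odd k \<or> k = 0" by (auto elim!: evenE)
            then show "(A3 x - 1) $ k * A3 ?x2 $ (m - k) = 0"
              by (auto simp: A3_nth coeff132_0)
          qed
        qed auto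
        also have "\<dots> = (if even m then \<Sum>k\<in>?K. coeff132 ?x2 (m - k) * coeff132 x k else 0)"
          by (auto simp: A3_nth intro!: sum.cong sum.neutral)
        finally show ?thesis .
      qed
      show ?thesis
      proof (cases "even m")
        case True
        have "coeff132 ?x1 (Suc m - k) = coeff132 ?x2 (m - k)" if "k \<in> ?K" for k
          using that True coeff132_odd[of "m - k" ?x1] unfolding x2 by (simp add: Suc_diff_le)
        then have "(\<Sum>k\<in>?K. coeff132 ?x1 (Suc m - k) * coeff132 x k) =
            (\<Sum>k\<in>?K. coeff132 ?x2 (m - k) * coeff132 x k)"
          by (intro sum.cong refl) simp
        then have "coeff132 x n = x 2 *
            (coeff132 ?x1 m + (\<Sum>k\<in>?K. coeff132 ?x2 (m - k) * coeff132 x k))"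
          using True unfolding n
          by (subst coeff132_even) (simp_all add: coeff132_0 coeff132_odd)
        then show ?thesis
          using True conv by (simp add: n A3_nth fps_X_power_mult_nth)
      next
        case False
        then show ?thesis using conv by (simp add: n A3_nth fps_X_power_mult_nth)
      qed
    qed
  qed
  then show ?thesis by (simp only: distrib_left mult.assoc)
qed

theorem theorem2p14:
  fixes x :: "nat \<Rightarrow> 'a::field_char_0"
  shows "A3 x =
           1 + (fps_X ^ 2 * fps_const (x 2) * A3 (\<lambda>j. x j * x (j + 1))) /
               (1 - fps_X ^ 2 * fps_const (x 2) * A3 (\<lambda>j. x j * x (j + 1) ^ 2 * x (j + 2)))
         \<and> B3 x = fps_X * A3 (\<lambda>j. x j * x (j + 1))"
proof
  let ?N = "fps_X ^ 2 * fps_const (x 2) * A3 (\<lambda>j. x j * x (j + 1))"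
  let ?D = "1 - fps_X ^ 2 * fps_const (x 2) * A3 (\<lambda>j. x j * x (j + 1) ^ 2 * x (j + 2))"
  \<comment> \<open>The factor \<open>fps_X ^ 2\<close> removes the constant term of the product, so
    the denominator is a unit.\<close>
  have "?D $ 0 = 1" by simp
  then have unit: "?D $ 0 \<noteq> 0" by simp
  \<comment> \<open>The two terms of the recurrence that contain \<open>A3 x - 1\<close> are
    collected on one side.\<close>
  have "?N = (A3 x - 1) * ?D"
    using A3_recurrence[of x] by (simp add: algebra_simps)
  then have "?N / ?D = A3 x - 1"
    by (simp only: fps_mult_divide_cancel[OF unit])
  then show "A3 x = 1 + ?N / ?D" by simp
qed (rule B3_eq)

end
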